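(* Let $G$ be a topological group and let $\pi$ be a unitary representation of $G$ on a Hilbert space $\mathcal H$. There exists an irreducible affine isometric action $\alpha$ of $G$ on $\mathcal H$ with linear part $\pi$ if and only if $H^1(G,\pi)$ admits a separating vector for $\pi(G)'$.
   Context: An affine isometric action of $G$ with linear part $\pi$ has the form $\alpha(g)v=\pi(g)v+b(g)$ with $b\in Z^1(G,\pi)$, the space of continuous maps $b:G\to\mathcal H$ with $b(gh)=b(g)+\pi(g)b(h)$. It is irreducible if $\mathcal H$ has no non-empty, closed, proper $\alpha(G)$-invariant affine subspace. $B^1(G,\pi)=\{g\mapsto\pi(g)v-v: v\in\mathcal H\}$ and $H^1(G,\pi)=Z^1(G,\pi)/B^1(G,\pi)$. The commutant $\pi(G)'=\{T\in\mathcal B(\mathcal H): T\pi(g)=\pi(g)T\ \forall g\in G\}$ acts on $Z^1(G,\pi)$ by $(Tb)(g)=T(b(g))$, and this descends to an action on $H^1(G,\pi)$. A vector $\xi$ in a module over $M=\pi(G)'$ is separating if, for $S\in M$, $S\xi=0$ implies $S=0$. *)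

theory Defs
  imports "HOL-Analysis.Analysis"
begin

text \<open>
  Complex Hilbert spaces. The complex structure extends a complete real inner product space
  whose inner product is the real part of the complex one; hence the norm of the type is the
  one induced by \<open>cinner\<close>. The form \<open>cinner\<close> is linear in its first argument.
\<close>

class complex_hilbert_space = real_inner + banach +
  fixes scaleC :: "complex \<Rightarrow> 'a \<Rightarrow> 'a"  (infixr "*\<^sub>C" 75)
    and cinner :: "'a \<Rightarrow> 'a \<Rightarrow> complex"
  assumes scaleC_add_right: "c *\<^sub>C (x + y) = c *\<^sub>C x + c *\<^sub>C y"
    and scaleC_add_left: "(c + d) *\<^sub>C x = c *\<^sub>C x + d *\<^sub>C x"
    and scaleC_scaleC: "c *\<^sub>C d *\<^sub>C x = (c * d) *\<^sub>C x"
    and scaleR_scaleC: "scaleR r x = complex_of_real r *\<^sub>C x"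
    and cinner_commute: "cinner x y = cnj (cinner y x)"
    and cinner_add_left: "cinner (x + y) z = cinner x z + cinner y z"
    and cinner_scaleC_left: "cinner (c *\<^sub>C x) y = c * cinner x y"
    and inner_eq_Re_cinner: "inner x y = Re (cinner x y)"

definition bounded_operator :: "('h::complex_hilbert_space \<Rightarrow> 'h) \<Rightarrow> bool"
  where "bounded_operator T \<longleftrightarrow> bounded_linear T \<and> (\<forall>c x. T (c *\<^sub>C x) = c *\<^sub>C T x)"

definition unitary_operator :: "('h::complex_hilbert_space \<Rightarrow> 'h) \<Rightarrow> bool"
  where "unitary_operator U \<longleftrightarrow>
    bounded_operator U \<and> surj U \<and> (\<forall>x y. cinner (U x) (U y) = cinner x y)"

definition complex_affine :: "'h::complex_hilbert_space set \<Rightarrow> bool"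
  where "complex_affine S \<longleftrightarrow>
    (\<forall>x\<in>S. \<forall>y\<in>S. \<forall>c d. c + d = 1 \<longrightarrow> c *\<^sub>C x + d *\<^sub>C y \<in> S)"

text \<open>
  The group \<open>G\<close> is a type of class \<open>topological_group_add\<close>. Its operation is written additively
  but is not assumed to be commutative, so \<open>g + h\<close>, \<open>0\<close> and \<open>- g\<close> stand for \<open>gh\<close>, \<open>e\<close> and the
  inverse of \<open>g\<close>. Unitary representations are strongly continuous.
\<close>

definition unitary_representation ::
    "('g::topological_group_add \<Rightarrow> 'h::complex_hilbert_space \<Rightarrow> 'h) \<Rightarrow> bool"
  where "unitary_representation \<pi> \<longleftrightarrow>
    (\<forall>g. unitary_operator (\<pi> g)) \<and>
    \<pi> 0 = id \<and>
    (\<forall>g h. \<pi> (g + h) = \<pi> g \<circ> \<pi> h) \<and>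
    (\<forall>v. continuous_on UNIV (\<lambda>g. \<pi> g v))"

definition Z1 ::
    "('g::topological_group_add \<Rightarrow> 'h::complex_hilbert_space \<Rightarrow> 'h) \<Rightarrow> ('g \<Rightarrow> 'h) set"
  where "Z1 \<pi> = {b. continuous_on UNIV b \<and> (\<forall>g h. b (g + h) = b g + \<pi> g (b h))}"

definition B1 ::
    "('g::topological_group_add \<Rightarrow> 'h::complex_hilbert_space \<Rightarrow> 'h) \<Rightarrow> ('g \<Rightarrow> 'h) set"
  where "B1 \<pi> = {\<lambda>g. \<pi> g v - v | v. True}"

definition cohomologous ::
    "('g::topological_group_add \<Rightarrow> 'h::complex_hilbert_space \<Rightarrow> 'h) \<Rightarrow> (('g \<Rightarrow> 'h) \<times> ('g \<Rightarrow> 'h)) set"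
  where "cohomologous \<pi> =
    {(b, b'). b \<in> Z1 \<pi> \<and> b' \<in> Z1 \<pi> \<and> (\<lambda>g. b g - b' g) \<in> B1 \<pi>}"

definition H1 ::
    "('g::topological_group_add \<Rightarrow> 'h::complex_hilbert_space \<Rightarrow> 'h) \<Rightarrow> ('g \<Rightarrow> 'h) set set"
  where "H1 \<pi> = Z1 \<pi> // cohomologous \<pi>"

definition H1_class ::
    "('g::topological_group_add \<Rightarrow> 'h::complex_hilbert_space \<Rightarrow> 'h) \<Rightarrow> ('g \<Rightarrow> 'h) \<Rightarrow> ('g \<Rightarrow> 'h) set"
  where "H1_class \<pi> b = cohomologous \<pi> `` {b}"

definition commutant ::
    "('g::topological_group_add \<Rightarrow> 'h::complex_hilbert_space \<Rightarrow> 'h) \<Rightarrow> ('h \<Rightarrow> 'h) set"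
  where "commutant \<pi> = {T. bounded_operator T \<and> (\<forall>g. T \<circ> \<pi> g = \<pi> g \<circ> T)}"

text \<open>
  The action of the commutant on \<open>H1 \<pi>\<close> induced by \<open>(T b)(g) = T (b g)\<close>; the union over the
  representatives \<open>b\<close> of \<open>\<xi>\<close> is a union of equal sets, see \<open>H1_act_class\<close> below.
\<close>

definition H1_act ::
    "('g::topological_group_add \<Rightarrow> 'h::complex_hilbert_space \<Rightarrow> 'h) \<Rightarrow> ('h \<Rightarrow> 'h)
      \<Rightarrow> ('g \<Rightarrow> 'h) set \<Rightarrow> ('g \<Rightarrow> 'h) set"
  where "H1_act \<pi> T \<xi> = (\<Union>b\<in>\<xi>. H1_class \<pi> (\<lambda>g. T (b g)))"

definition H1_separating ::
    "('g::topological_group_add \<Rightarrow> 'h::complex_hilbert_space \<Rightarrow> 'h) \<Rightarrow> ('g \<Rightarrow> 'h) set \<Rightarrow> bool"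
  where "H1_separating \<pi> \<xi> \<longleftrightarrow>
    \<xi> \<in> H1 \<pi> \<and>
    (\<forall>S\<in>commutant \<pi>. H1_act \<pi> S \<xi> = H1_class \<pi> (\<lambda>_. 0) \<longrightarrow> S = (\<lambda>_. 0))"

definition affine_isometric_action ::
    "('g::topological_group_add \<Rightarrow> 'h::complex_hilbert_space \<Rightarrow> 'h) \<Rightarrow> ('g \<Rightarrow> 'h \<Rightarrow> 'h) \<Rightarrow> bool"
  where "affine_isometric_action \<pi> \<alpha> \<longleftrightarrow> (\<exists>b\<in>Z1 \<pi>. \<forall>g v. \<alpha> g v = \<pi> g v + b g)"

definition irreducible_action :: "('g \<Rightarrow> 'h::complex_hilbert_space \<Rightarrow> 'h) \<Rightarrow> bool"
  where "irreducible_action \<alpha> \<longleftrightarrow>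
    \<not> (\<exists>S. S \<noteq> {} \<and> S \<noteq> UNIV \<and> closed S \<and> complex_affine S \<and> (\<forall>g. \<alpha> g ` S \<subseteq> S))"

lemma bounded_operator_simps:
  assumes "bounded_operator T"
  shows "T (x + y) = T x + T y" "T (x - y) = T x - T y" "T (- x) = - T x" "T 0 = 0"
  using assms unfolding bounded_operator_def
  by (simp_all add: linear_simps linear_0 bounded_linear.linear)

lemma commutant_Z1:
  assumes "T \<in> commutant \<pi>" "b \<in> Z1 \<pi>"
  shows "(\<lambda>g. T (b g)) \<in> Z1 \<pi>"
proof -
  have T: "bounded_operator T" "\<And>g v. T (\<pi> g v) = \<pi> g (T v)"
    using assms(1) unfolding commutant_def by (auto simp: fun_eq_iff)
  have "continuous_on UNIV (\<lambda>g. T (b g))"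
    using T(1) assms(2) unfolding bounded_operator_def Z1_def
    by (auto intro: bounded_linear.continuous_on)
  then show ?thesis
    using assms(2) T by (simp add: Z1_def bounded_operator_simps)
qed

lemma commutant_B1:
  assumes "T \<in> commutant \<pi>" "b \<in> B1 \<pi>"
  shows "(\<lambda>g. T (b g)) \<in> B1 \<pi>"
proof -
  have T: "bounded_operator T" "\<And>g v. T (\<pi> g v) = \<pi> g (T v)"
    using assms(1) unfolding commutant_def by (auto simp: fun_eq_iff)
  show ?thesis
    using assms(2) T by (auto simp: B1_def bounded_operator_simps)
qed

context
  fixes \<pi> :: "'g::topological_group_add \<Rightarrow> 'h::complex_hilbert_space \<Rightarrow> 'h"
  assumes rep: "unitary_representation \<pi>"
begin

lemma rep_linear: "bounded_operator (\<pi> g)"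
  using rep by (simp add: unitary_representation_def unitary_operator_def)

lemma B1_subset_Z1: "B1 \<pi> \<subseteq> Z1 \<pi>"
  using rep by (auto simp: B1_def Z1_def unitary_representation_def
      bounded_operator_simps[OF rep_linear] intro!: continuous_intros)

lemma zero_in_B1: "(\<lambda>_. 0) \<in> B1 \<pi>"
  by (auto simp: B1_def bounded_operator_simps[OF rep_linear] intro!: exI[of _ 0])

lemma B1_add:
  assumes "b \<in> B1 \<pi>" "c \<in> B1 \<pi>"
  shows "(\<lambda>g. b g + c g) \<in> B1 \<pi>"
proof -
  obtain v w where "b = (\<lambda>g. \<pi> g v - v)" "c = (\<lambda>g. \<pi> g w - w)"
    using assms by (auto simp: B1_def)
  then have "(\<lambda>g. b g + c g) = (\<lambda>g. \<pi> g (v + w) - (v + w))"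
    by (auto simp: bounded_operator_simps[OF rep_linear])
  then show ?thesis unfolding B1_def by blast
qed

lemma B1_uminus:
  assumes "b \<in> B1 \<pi>"
  shows "(\<lambda>g. - b g) \<in> B1 \<pi>"
proof -
  obtain v where "b = (\<lambda>g. \<pi> g v - v)"
    using assms by (auto simp: B1_def)
  then have "(\<lambda>g. - b g) = (\<lambda>g. \<pi> g (- v) - (- v))"
    by (auto simp: bounded_operator_simps[OF rep_linear])
  then show ?thesis unfolding B1_def by blast
qed

lemma equiv_cohomologous: "equiv (Z1 \<pi>) (cohomologous \<pi>)"
proof (rule equivI)
  show "cohomologous \<pi> \<subseteq> Z1 \<pi> \<times> Z1 \<pi>"
    by (auto simp: cohomologous_def)
  show "refl_on (Z1 \<pi>) (cohomologous \<pi>)"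
    by (auto simp: refl_on_def cohomologous_def zero_in_B1)
  show "sym (cohomologous \<pi>)"
    using B1_uminus by (force simp: sym_def cohomologous_def)
  show "trans (cohomologous \<pi>)"
  proof (rule transI)
    fix b c d assume *: "(b, c) \<in> cohomologous \<pi>" "(c, d) \<in> cohomologous \<pi>"
    then have "(\<lambda>g. (b g - c g) + (c g - d g)) \<in> B1 \<pi>"
      by (intro B1_add) (auto simp: cohomologous_def)
    with * show "(b, d) \<in> cohomologous \<pi>" by (simp add: cohomologous_def)
  qed
qed

lemma H1_class_zero: "H1_class \<pi> (\<lambda>_. 0) = B1 \<pi>"
  using B1_subset_Z1 zero_in_B1 B1_uminus
  by (force simp: H1_class_def cohomologous_def)

lemma H1_act_class:
  assumes T: "T \<in> commutant \<pi>" and b: "b \<in> Z1 \<pi>"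
  shows "H1_act \<pi> T (H1_class \<pi> b) = H1_class \<pi> (\<lambda>g. T (b g))"
proof -
  have "H1_class \<pi> (\<lambda>g. T (c g)) = H1_class \<pi> (\<lambda>g. T (d g))"
    if "(c, d) \<in> cohomologous \<pi>" for c d
  proof -
    have "bounded_operator T" using T by (simp add: commutant_def)
    moreover have "(\<lambda>g. T (c g - d g)) \<in> B1 \<pi>"
      using commutant_B1[OF T, of "\<lambda>g. c g - d g"] that by (simp add: cohomologous_def)
    ultimately have "(\<lambda>g. T (c g), \<lambda>g. T (d g)) \<in> cohomologous \<pi>"
      using that commutant_Z1[OF T] by (simp add: cohomologous_def bounded_operator_simps)
    then show ?thesis
      unfolding H1_class_def by (rule equiv_class_eq[OF equiv_cohomologous])
  qed
  then have "(\<lambda>c. H1_class \<pi> (\<lambda>g. T (c g))) respects cohomologous \<pi>"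
    by (auto simp: congruent_def)
  from UN_equiv_class[OF equiv_cohomologous this b] show ?thesis
    by (simp add: H1_act_def H1_class_def)
qed

end

end

theory Submission
  imports Defs
begin

text \<open>
  A cocycle \<open>b\<close> gives an irreducible action iff its class is separating. If \<open>E = s + K\<close> is a proper
  closed invariant affine subspace, the projection onto the orthogonal complement of \<open>K\<close> lies in the
  commutant, is non-zero and maps \<open>b\<close> to a coboundary. Conversely, let \<open>S \<noteq> 0\<close> in the commutant map
  \<open>b\<close> to the coboundary of \<open>v\<close>. Then \<open>T = S\<^sup>* S\<close> maps \<open>b\<close> to the coboundary of \<open>S\<^sup>* v\<close>. There is an
  invariant closed subspace \<open>L \<noteq> {0}\<close> on which \<open>T\<close> is bounded below, hence invertible; with \<open>P\<close>
  the projection onto \<open>L\<close>, \<open>P b\<close> is the coboundary of the \<open>w \<in> L\<close> with \<open>T w = P S\<^sup>* v\<close>, so that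
  \<open>{x. P x + w = 0}\<close> is a proper invariant affine subspace.

  Instead of the spectral theorem, only a square root is used: with \<open>A\<close> a multiple of \<open>T - k\<close> and
  \<open>B = |A|\<close>, take \<open>L = ker (B - A)\<close>, which contains the range of \<open>B + A\<close>.
\<close>

section \<open>Orthogonal projections and adjoints\<close>

text \<open>A minimising sequence without sequences: the points of \<open>K\<close> within
  \<open>d + 1 / Suc n\<close> of \<open>x\<close> form nested closed sets whose diameters tend to
  0, so completeness yields a common point \<open>p\<close>. It attains the distance
  \<open>d\<close>, and minimality forces orthogonality.\<close>

lemma ex_orthogonal_projection:
  fixes K :: "'a::{real_inner,banach} set"
  assumes K: "closed K" "subspace K"
  shows "\<exists>p\<in>K. \<forall>y\<in>K. inner (x - p) y = 0"
proof -
  define d where "d = infdist x K"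
  have ne: "K \<noteq> {}" using subspace_0[OF K(2)] by auto
  have d0: "0 \<le> d" by (simp add: d_def infdist_nonneg)
  have dle: "d \<le> norm (x - y)" if "y \<in> K" for y
    using infdist_le[OF that, of x] by (simp add: d_def dist_norm)
  define S where "S = (\<lambda>n. K \<inter> cball x (d + 1 / Suc n))"
  have close: "(dist y z)\<^sup>2 \<le> 4 * ((d + 1 / Suc n)\<^sup>2 - d\<^sup>2)"
    if "y \<in> S n" "z \<in> S n" for y z n
  proof -
    have m: "(1/2) *\<^sub>R (y + z) \<in> K"
      using that K(2) by (auto simp: S_def intro: subspace_scale subspace_add)
    have "(norm (x - y))\<^sup>2 \<le> (d + 1 / Suc n)\<^sup>2" "(norm (x - z))\<^sup>2 \<le> (d + 1 / Suc n)\<^sup>2"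
      using that by (auto simp: S_def dist_norm intro!: power_mono)
    \<comment> \<open>The midpoint of \<open>y\<close> and \<open>z\<close> lies in
      \<open>K\<close>, so its distance from \<open>x\<close> is at least \<open>d\<close>; the
      parallelogram law then bounds \<open>norm (y - z)\<close>.\<close>
    moreover have "d\<^sup>2 \<le> (norm (x - (1/2) *\<^sub>R (y + z)))\<^sup>2"
      using dle[OF m] d0 by (intro power_mono) auto
    moreover have "(norm (y - z))\<^sup>2
        = 2 * (norm (x - y))\<^sup>2 + 2 * (norm (x - z))\<^sup>2 - 4 * (norm (x - (1/2) *\<^sub>R (y + z)))\<^sup>2"
      by (simp add: power2_norm_eq_inner inner_simps inner_commute algebra_simps)
    ultimately show ?thesis by (simp add: dist_norm)
  qed
  have "\<exists>a. \<forall>n. a \<in> S n"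
  proof (rule decreasing_closed_nest[of S])
    show "closed (S n)" for n using K(1) by (auto simp: S_def)
    show "S n \<noteq> {}" for n
    proof -
      have "infdist x K < d + 1 / Suc n" by (simp add: d_def)
      then obtain y where "y \<in> K" "dist x y < d + 1 / Suc n"
        using ne by (auto simp: infdist_def cINF_less_iff)
      then show ?thesis by (force simp: S_def)
    qed
    show "S n \<subseteq> S m" if "m \<le> n" for m n
    proof -
      have "1 / real (Suc n) \<le> 1 / Suc m" using that by (intro divide_left_mono) auto
      then show ?thesis by (auto simp: S_def)
    qed
    show "\<exists>a. \<forall>n. a \<in> S n" if "\<And>n. a \<in> S n" for a using that by blast
    fix e :: real assume e: "0 < e"
    have "(\<lambda>n. 4 * ((d + 1 / Suc n)\<^sup>2 - d\<^sup>2)) \<longlonglongrightarrow> 4 * ((d + 0)\<^sup>2 - d\<^sup>2)"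
      by (intro tendsto_intros LIMSEQ_inverse_real_of_nat[unfolded inverse_eq_divide])
    then have "\<forall>\<^sub>F n in sequentially. 4 * ((d + 1 / Suc n)\<^sup>2 - d\<^sup>2) < e\<^sup>2"
      using e by (intro order_tendstoD(2)) auto
    then obtain n where "4 * ((d + 1 / Suc n)\<^sup>2 - d\<^sup>2) < e\<^sup>2"
      by (auto simp: eventually_sequentially)
    then have "dist y z < e" if "y \<in> S n" "z \<in> S n" for y z
      using close[OF that] e by (intro power2_less_imp_less[of _ e]) auto
    then show "\<exists>n. \<forall>x\<in>S n. \<forall>y\<in>S n. dist x y < e" by blast
  qed
  then obtain p where p: "p \<in> K" "\<And>n. dist x p \<le> d + 1 / Suc n"
    by (auto simp: S_def)
  have "(\<lambda>n. d + 1 / Suc n) \<longlonglongrightarrow> d + 0"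
    by (intro tendsto_intros LIMSEQ_inverse_real_of_nat[unfolded inverse_eq_divide])
  then have pd: "norm (x - p) \<le> d"
    using p(2) by (intro LIMSEQ_le_const[of _ d]) (auto simp: dist_norm)
  have "inner (x - p) y = 0" if y: "y \<in> K" for y
  proof (cases "y = 0")
    case False
    \<comment> \<open>This \<open>t\<close> minimises the norm of
      \<open>(x - p) - t *\<^sub>R y\<close>; the gain over \<open>t = 0\<close> is the square of
      \<open>inner (x - p) y\<close> divided by \<open>inner y y\<close>.\<close>
    define t where "t = inner (x - p) y / inner y y"
    have "p + t *\<^sub>R y \<in> K" using p(1) y K(2) by (auto intro: subspace_add subspace_scale)
    from dle[OF this] pd have "(norm (x - p))\<^sup>2 \<le> (norm ((x - p) - t *\<^sub>R y))\<^sup>2"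
      by (intro power_mono) (auto simp: algebra_simps)
    also have "\<dots> = (norm (x - p))\<^sup>2 - 2 * t * inner (x - p) y + t\<^sup>2 * inner y y"
      unfolding power2_norm_eq_inner
      by (simp add: inner_simps inner_commute algebra_simps power2_eq_square)
    also have "\<dots> = (norm (x - p))\<^sup>2 - (inner (x - p) y)\<^sup>2 / inner y y"
      using False by (simp add: t_def field_simps power2_eq_square)
    finally have le: "(inner (x - p) y)\<^sup>2 / inner y y \<le> 0" by simp
    have "0 < inner y y" using False by simp
    from le[unfolded pos_divide_le_eq[OF this]] show ?thesis by simp
  qed auto
  with p(1) show ?thesis by blast
qed

definition orth_proj :: "'a::{real_inner,banach} set \<Rightarrow> 'a \<Rightarrow> 'a"
  where "orth_proj K x = (SOME p. p \<in> K \<and> (\<forall>y\<in>K. inner (x - p) y = 0))"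

context
  fixes K :: "'a::{real_inner,banach} set"
  assumes K: "closed K" "subspace K"
begin

lemma orth_proj_in: "orth_proj K x \<in> K"
  and orth_proj_orth: "y \<in> K \<Longrightarrow> inner (x - orth_proj K x) y = 0"
  using someI_ex[OF ex_orthogonal_projection[OF K, of x, unfolded Bex_def]]
  by (auto simp: orth_proj_def)

text \<open>The difference of two candidates lies in \<open>K\<close> and is orthogonal to
  \<open>K\<close>, hence to itself. Identities for the projection are proved below by checking
  these two properties of the claimed value.\<close>

lemma orth_proj_eqI:
  assumes p: "p \<in> K" "\<And>y. y \<in> K \<Longrightarrow> inner (x - p) y = 0"
  shows "orth_proj K x = p"
proof -
  have *: "orth_proj K x - p \<in> K" using K(2) p orth_proj_in by (simp add: subspace_diff)
  have "inner (orth_proj K x - p) (orth_proj K x - p)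
      = inner (x - p) (orth_proj K x - p) - inner (x - orth_proj K x) (orth_proj K x - p)"
    by (simp add: inner_simps)
  also have "\<dots> = 0" using p(2)[OF *] orth_proj_orth[OF *] by simp
  finally show ?thesis by simp
qed

lemma orth_proj_ident: "x \<in> K \<Longrightarrow> orth_proj K x = x"
  by (rule orth_proj_eqI) auto

lemma bounded_linear_orth_proj: "bounded_linear (orth_proj K)"
proof (rule bounded_linear_intro[where K = 1])
  fix x y show "orth_proj K (x + y) = orth_proj K x + orth_proj K y"
  proof (rule orth_proj_eqI)
    show "orth_proj K x + orth_proj K y \<in> K"
      using K(2) orth_proj_in by (simp add: subspace_add)
    fix z assume z: "z \<in> K"
    show "inner (x + y - (orth_proj K x + orth_proj K y)) z = 0"
      using orth_proj_orth[OF z, of x] orth_proj_orth[OF z, of y] by (simp add: inner_simps)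
  qed
next
  fix r x show "orth_proj K (r *\<^sub>R x) = r *\<^sub>R orth_proj K x"
  proof (rule orth_proj_eqI)
    show "r *\<^sub>R orth_proj K x \<in> K"
      using K(2) orth_proj_in by (simp add: subspace_scale)
    fix z assume z: "z \<in> K"
    show "inner (r *\<^sub>R x - r *\<^sub>R orth_proj K x) z = 0"
      using orth_proj_orth[OF z, of x] by (simp add: inner_simps)
  qed
next
  fix x
  have "(norm (orth_proj K x))\<^sup>2 = inner x (orth_proj K x)"
    using orth_proj_orth[OF orth_proj_in, of x x] by (simp add: power2_norm_eq_inner inner_simps)
  also have "\<dots> \<le> norm x * norm (orth_proj K x)" by (rule norm_cauchy_schwarz)
  finally have "norm (orth_proj K x) \<le> norm x"
    by (cases "orth_proj K x = 0") (auto simp: power2_eq_square)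
  then show "norm (orth_proj K x) \<le> norm x * 1" by simp
qed

text \<open>Invariance of \<open>K\<close> under the adjoint \<open>C'\<close> makes
  \<open>C\<close> preserve the orthogonal complement as well, so \<open>C\<close> respects the
  decomposition of \<open>x\<close>.\<close>

lemma orth_proj_commute:
  assumes C: "linear C" "\<And>x y. inner (C x) y = inner x (C' y)"
    and inv: "\<And>x. x \<in> K \<Longrightarrow> C x \<in> K" "\<And>x. x \<in> K \<Longrightarrow> C' x \<in> K"
  shows "orth_proj K (C x) = C (orth_proj K x)"
proof (rule orth_proj_eqI)
  show "C (orth_proj K x) \<in> K" by (simp add: inv orth_proj_in)
  fix y assume "y \<in> K"
  then have "inner (x - orth_proj K x) (C' y) = 0" by (simp add: inv orth_proj_orth)
  then show "inner (C x - C (orth_proj K x)) y = 0"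
    by (simp add: C(2) flip: linear_diff[OF C(1)])
qed

end

section \<open>Riesz representation and real adjoints\<close>

lemma riesz_representation:
  fixes f :: "'a::{real_inner,banach} \<Rightarrow> real"
  assumes "bounded_linear f"
  shows "\<exists>z. \<forall>x. f x = inner x z"
proof (cases "\<forall>x. f x = 0")
  case False
  interpret f: bounded_linear f by fact
  from False obtain u where u: "f u \<noteq> 0" by auto
  let ?N = "{x. f x = 0}"
  have N: "closed ?N" "subspace ?N"
    by (auto simp: subspace_def f.add f.scaleR f.zero
        intro!: closed_Collect_eq continuous_intros f.continuous_on)
  \<comment> \<open>The component of \<open>u\<close> orthogonal to the kernel. The kernel has
    codimension one, so \<open>e\<close> spans its orthogonal complement.\<close>
  define e where "e = u - orth_proj ?N u"
  have fe: "f e = f u" using orth_proj_in[OF N, of u] by (simp add: e_def f.diff)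
  then have e0: "e \<noteq> 0" using u by (auto simp: f.zero)
  have "f x = inner x ((f e / inner e e) *\<^sub>R e)" for x
  proof -
    have "f (x - (f x / f e) *\<^sub>R e) = 0" using u fe by (simp add: f.diff f.scaleR)
    then have "inner e (x - (f x / f e) *\<^sub>R e) = 0"
      unfolding e_def by (intro orth_proj_orth[OF N]) simp
    then show ?thesis using u fe e0 by (simp add: inner_simps inner_commute field_simps)
  qed
  then show ?thesis by blast
qed (auto intro: exI[of _ 0])

text \<open>Riesz representation applied to \<open>inner (S x) y\<close> as a functional of
  \<open>x\<close>. Only the real inner product enters; compatibility with complex scalars is
  established where the adjoint is used.\<close>

lemma ex_adjoint:
  fixes S :: "'a::{real_inner,banach} \<Rightarrow> 'a"
  assumes "bounded_linear S"
  obtains S' where "bounded_linear S'" "\<And>x y. inner (S x) y = inner x (S' y)"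
proof -
  interpret S: bounded_linear S by fact
  have "\<exists>z. \<forall>x. inner (S x) y = inner x z" for y
    by (intro riesz_representation bounded_linear_compose[OF bounded_linear_inner_left assms])
  then obtain S' where S': "\<And>x y. inner (S x) y = inner x (S' y)" by metis
  obtain k where k: "\<And>x. norm (S x) \<le> norm x * k" "0 \<le> k" using S.nonneg_bounded by blast
  have "bounded_linear S'"
  proof (rule bounded_linear_intro[where K = k])
    show "S' (x + y) = S' x + S' y" for x y
      by (rule vector_eq_ldot[THEN iffD1]) (simp add: inner_simps flip: S')
    show "S' (r *\<^sub>R x) = r *\<^sub>R S' x" for r x
      by (rule vector_eq_ldot[THEN iffD1]) (simp add: inner_simps flip: S')
    fix y
    have "(norm (S' y))\<^sup>2 = inner (S (S' y)) y" by (simp add: S' power2_norm_eq_inner)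
    also have "\<dots> \<le> norm (S (S' y)) * norm y" by (rule norm_cauchy_schwarz)
    also have "\<dots> \<le> norm (S' y) * k * norm y" by (intro mult_right_mono k) auto
    finally show "norm (S' y) \<le> norm y * k"
      by (cases "S' y = 0") (auto simp: power2_eq_square k mult_ac)
  qed
  with S' that show ?thesis by blast
qed

section \<open>A spectral subspace of a self-adjoint operator\<close>

text \<open>
  The iteration \<open>Y \<mapsto> (X + Y\<^sup>2) / 2\<close> converges in norm to a solution of \<open>(1 - Y)\<^sup>2 = 1 - X\<close> when
  \<open>X\<close> is a contraction.
\<close>

fun sqrt_iter :: "('a::real_vector \<Rightarrow> 'a) \<Rightarrow> nat \<Rightarrow> 'a \<Rightarrow> 'a" where
  "sqrt_iter X 0 x = 0"
| "sqrt_iter X (Suc n) x = (1/2) *\<^sub>R (X x + sqrt_iter X n (sqrt_iter X n x))"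

text \<open>The iteration in the scalar case \<open>X = 1\<close> dominates all others.\<close>

fun sqrt_bd :: "nat \<Rightarrow> real" where
  "sqrt_bd 0 = 0"
| "sqrt_bd (Suc n) = (1 + (sqrt_bd n)\<^sup>2) / 2"

lemma sqrt_bd_range: "0 \<le> sqrt_bd n \<and> sqrt_bd n \<le> 1"
  by (induction n) (auto simp: power_le_one)

lemma sqrt_bd_mono: "sqrt_bd n \<le> sqrt_bd (Suc n)"
  \<comment> \<open>One step of the recursion increases the value \<open>t\<close> by
    \<open>(1 - t)^2 / 2\<close>.\<close>
  using sum_power2_ge_zero[of "1 - sqrt_bd n" 0] by (simp add: power2_eq_square algebra_simps)

lemma convergent_sqrt_bd: "convergent sqrt_bd"
  using sqrt_bd_range sqrt_bd_mono
  by (intro Bseq_monoseq_convergent BseqI'[of _ 1] incseq_imp_monoseq incseq_SucI) auto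

lemma linear_sqrt_iter: "linear X \<Longrightarrow> linear (sqrt_iter X n)"
proof (induction n)
  case 0 then show ?case by (auto intro: linearI)
next
  case (Suc n)
  then interpret X: linear X by simp
  interpret Y: linear "sqrt_iter X n" using Suc by simp
  show ?case by (rule linearI) (simp_all add: X.add X.scaleR Y.add Y.scaleR algebra_simps)
qed

text \<open>For linear \<open>X\<close> each iterate is a polynomial in \<open>X\<close> without
  constant term, so whatever commutes with \<open>X\<close> commutes with it.\<close>

lemma sqrt_iter_commute:
  assumes "linear C" "\<And>x. C (X x) = X (C x)"
  shows "C (sqrt_iter X n x) = sqrt_iter X n (C x)"
  by (induction n arbitrary: x)
    (simp_all add: assms(2) linear_0[OF assms(1)] linear_add[OF assms(1)] linear_scale[OF assms(1)])

lemma sqrt_iter_commute_iter: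
  "linear X \<Longrightarrow> sqrt_iter X m (sqrt_iter X n x) = sqrt_iter X n (sqrt_iter X m x)"
  by (intro sqrt_iter_commute linear_sqrt_iter) (simp_all add: sqrt_iter_commute)

lemma norm_sqrt_iter_le:
  assumes "\<And>x. norm (X x) \<le> norm (x :: 'a::real_normed_vector)"
  shows "norm (sqrt_iter X n x) \<le> sqrt_bd n * norm x"
proof (induction n arbitrary: x)
  case (Suc n)
  have "norm (sqrt_iter X n (sqrt_iter X n x)) \<le> sqrt_bd n * (sqrt_bd n * norm x)"
    using Suc sqrt_bd_range[of n] by (meson mult_left_mono order_trans)
  then have "norm (X x + sqrt_iter X n (sqrt_iter X n x)) \<le> (1 + (sqrt_bd n)\<^sup>2) * norm x"
    using norm_triangle_ineq[of "X x" "sqrt_iter X n (sqrt_iter X n x)"] assms[of x]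
    by (simp add: power2_eq_square algebra_simps)
  then show ?case by (simp del: scaleR_add_right)
qed auto

text \<open>The iterates commute, so a difference of their squares factors as difference times sum.
  The induction hypothesis bounds the first factor and \<open>sqrt_bd\<close> the second, which
  reproduces the scalar recursion.\<close>

lemma norm_sqrt_iter_diff_le:
  fixes X :: "'a::real_normed_vector \<Rightarrow> 'a"
  assumes X: "linear X" "\<And>x. norm (X x) \<le> norm x"
  shows "norm (sqrt_iter X (Suc n) x - sqrt_iter X n x) \<le> (sqrt_bd (Suc n) - sqrt_bd n) * norm x"
proof (induction n arbitrary: x)
  case 0 then show ?case using X(2)[of x] by simp
next
  case (Suc n)
  let ?Y = "sqrt_iter X"
  let ?u = "?Y (Suc n) x + ?Y n x"
  have "?Y (Suc (Suc n)) x - ?Y (Suc n) x = (1/2) *\<^sub>R (?Y (Suc n) (?Y (Suc n) x) - ?Y n (?Y n x))"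
    by (simp only: sqrt_iter.simps(2)[of X "Suc n"] sqrt_iter.simps(2)[of X n x])
      (simp add: algebra_simps)
  also have "\<dots> = (1/2) *\<^sub>R (?Y (Suc n) ?u - ?Y n ?u)"
    by (simp only: linear_add[OF linear_sqrt_iter[OF X(1)]]
        sqrt_iter_commute_iter[OF X(1), of n "Suc n"]) simp
  finally have "norm (?Y (Suc (Suc n)) x - ?Y (Suc n) x) = norm (?Y (Suc n) ?u - ?Y n ?u) / 2"
    by simp
  also have "\<dots> \<le> (sqrt_bd (Suc n) - sqrt_bd n) * norm ?u / 2"
    using Suc[of ?u] by simp
  also have "\<dots> \<le> (sqrt_bd (Suc n) - sqrt_bd n) * ((sqrt_bd (Suc n) + sqrt_bd n) * norm x) / 2"
  proof -
    have "norm ?u \<le> (sqrt_bd (Suc n) + sqrt_bd n) * norm x"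
      using norm_triangle_ineq[of "?Y (Suc n) x" "?Y n x"]
        norm_sqrt_iter_le[of X, OF X(2), of "Suc n" x] norm_sqrt_iter_le[of X, OF X(2), of n x]
      by (simp only: distrib_right)
    then show ?thesis using sqrt_bd_mono[of n] by (intro divide_right_mono mult_left_mono) auto
  qed
  also have "\<dots> = (sqrt_bd (Suc (Suc n)) - sqrt_bd (Suc n)) * norm x"
  proof -
    have "sqrt_bd (Suc (Suc n)) - sqrt_bd (Suc n) = ((sqrt_bd (Suc n))\<^sup>2 - (sqrt_bd n)\<^sup>2) / 2"
      using sqrt_bd.simps(2)[of "Suc n"] sqrt_bd.simps(2)[of n] by argo
    then show ?thesis
      by (simp only:) (simp add: power2_eq_square algebra_simps del: sqrt_bd.simps)
  qed
  finally show ?case .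
qed

text \<open>The bounds on consecutive differences telescope to the convergent scalar sequence, so
  the iterates converge at every point. The recursion and the commutation property pass to the
  limit.\<close>

lemma sqrt_iter_limit:
  fixes X :: "'a::banach \<Rightarrow> 'a"
  assumes X: "bounded_linear X" "\<And>x. norm (X x) \<le> norm x"
  obtains Y where "bounded_linear Y" "\<And>x. norm (Y x) \<le> norm x" "\<And>x. 2 *\<^sub>R Y x = X x + Y (Y x)"
    "\<And>C x. bounded_linear C \<Longrightarrow> (\<And>x. C (X x) = X (C x)) \<Longrightarrow> C (Y x) = Y (C x)"
proof -
  let ?Y = "sqrt_iter X"
  have lX: "linear X" using X(1) by (simp add: bounded_linear.linear)
  note lin = linear_sqrt_iter[OF lX]
  have le: "norm (?Y n x) \<le> norm x" for n x
    using norm_sqrt_iter_le[of X, OF X(2), of n x] sqrt_bd_range[of n]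
    by (meson mult_left_le_one_le norm_ge_zero order_trans)
  have "summable (\<lambda>n. (sqrt_bd (Suc n) - sqrt_bd n) * norm x)" for x :: 'a
    using convergent_sqrt_bd unfolding convergent_LIMSEQ_iff
    by (intro summable_mult2 telescope_summable)
  then have "summable (\<lambda>n. ?Y (Suc n) x - ?Y n x)" for x
    by (rule summable_comparison_test'[where N = 0]) (rule norm_sqrt_iter_diff_le[OF lX X(2)])
  then have "convergent (\<lambda>n. ?Y n x)" for x
    unfolding summable_iff_convergent sum_lessThan_telescope[of "\<lambda>n. ?Y n _"] by simp
  then obtain Y where Y: "\<And>x. (\<lambda>n. ?Y n x) \<longlonglongrightarrow> Y x" unfolding convergent_def by metis
  have Yle: "norm (Y x) \<le> norm x" for x
    using le by (intro LIMSEQ_le_const2[OF tendsto_norm[OF Y]]) auto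
  have Ybl: "bounded_linear Y"
  proof (rule bounded_linear_intro[where K = 1])
    show "Y (x + y) = Y x + Y y" for x y
      by (rule LIMSEQ_unique[OF Y]) (simp add: linear_add[OF lin] tendsto_add Y)
    show "Y (r *\<^sub>R x) = r *\<^sub>R Y x" for r x
      by (rule LIMSEQ_unique[OF Y]) (simp add: linear_scale[OF lin] tendsto_scaleR Y)
    show "norm (Y x) \<le> norm x * 1" for x using Yle by simp
  qed
  have YY: "(\<lambda>n. ?Y n (?Y n x)) \<longlonglongrightarrow> Y (Y x)" for x
  proof -
    \<comment> \<open>Split \<open>?Y n (?Y n x)\<close> into \<open>?Y n (?Y n x - Y x)\<close> and
      \<open>?Y n (Y x)\<close>; all iterates are contractions, so the first term tends to
      0.\<close>
    have "(\<lambda>n. ?Y n x - Y x) \<longlonglongrightarrow> 0" using Y by (simp add: LIM_zero)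
    then have "(\<lambda>n. ?Y n (?Y n x - Y x)) \<longlonglongrightarrow> 0"
      by (rule tendsto_0_le[where K = 1]) (simp add: le)
    from tendsto_add[OF this Y[of "Y x"]] show ?thesis by (simp add: linear_diff[OF lin])
  qed
  have eq: "2 *\<^sub>R Y x = X x + Y (Y x)" for x
  proof -
    have "(\<lambda>n. 2 *\<^sub>R ?Y (Suc n) x) \<longlonglongrightarrow> X x + Y (Y x)"
      using tendsto_add[OF tendsto_const YY] by simp
    moreover have "(\<lambda>n. 2 *\<^sub>R ?Y (Suc n) x) \<longlonglongrightarrow> 2 *\<^sub>R Y x"
      by (intro tendsto_intros LIMSEQ_Suc[OF Y])
    ultimately show ?thesis by (rule LIMSEQ_unique[rotated])
  qed
  have "C (Y x) = Y (C x)" if C: "bounded_linear C" "\<And>x. C (X x) = X (C x)" for C x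
  proof -
    have "(\<lambda>n. C (?Y n x)) \<longlonglongrightarrow> C (Y x)" by (intro bounded_linear.tendsto[OF C(1)] Y)
    moreover have "C (?Y n x) = ?Y n (C x)" for n
      by (intro sqrt_iter_commute bounded_linear.linear C)
    ultimately show ?thesis using Y[of "C x"] by (auto intro: LIMSEQ_unique)
  qed
  with that Ybl Yle eq show ?thesis by blast
qed

section \<open>Absolute value and a spectral subspace\<close>

lemma ex_operator_abs:
  fixes A :: "'a::{real_inner,banach} \<Rightarrow> 'a"
  assumes A: "bounded_linear A" "\<And>x y. inner (A x) y = inner x (A y)" "\<And>x. norm (A x) \<le> norm x"
  obtains B where "bounded_linear B" "\<And>x. inner (B x) x \<ge> 0" "\<And>x. B (B x) = A (A x)"
    "\<And>C x. bounded_linear C \<Longrightarrow> (\<And>x. C (A x) = A (C x)) \<Longrightarrow> C (B x) = B (C x)"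
proof -
  interpret A: bounded_linear A by fact
  let ?X = "\<lambda>x. x - A (A x)"
  have X: "bounded_linear ?X"
    by (intro bounded_linear_sub bounded_linear_ident bounded_linear_compose[OF A(1) A(1)])
  have "norm (?X x) \<le> norm x" for x
  proof -
    \<comment> \<open>Symmetry turns the cross term into \<open>-2 * (norm (A x))^2\<close>, which
      outweighs the last term because \<open>A\<close> is a contraction.\<close>
    have "(norm (?X x))\<^sup>2 = (norm x)\<^sup>2 - 2 * (norm (A x))\<^sup>2 + (norm (A (A x)))\<^sup>2"
      unfolding power2_norm_eq_inner by (simp add: inner_simps A(2) inner_commute)
    also have "(norm (A (A x)))\<^sup>2 \<le> (norm (A x))\<^sup>2" by (intro power_mono A(3)) auto
    finally have "(norm (?X x))\<^sup>2 \<le> (norm x)\<^sup>2"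
      using zero_le_power2[of "norm (A x)"] by linarith
    then show ?thesis by (rule power2_le_imp_le) simp
  qed
  from sqrt_iter_limit[OF X this] obtain Y where Y: "bounded_linear Y" "\<And>x. norm (Y x) \<le> norm x"
    "\<And>x. 2 *\<^sub>R Y x = ?X x + Y (Y x)"
    "\<And>C x. bounded_linear C \<Longrightarrow> (\<And>x. C (?X x) = ?X (C x)) \<Longrightarrow> C (Y x) = Y (C x)"
    by blast
  show thesis
  \<comment> \<open>The equation for \<open>Y\<close> says that \<open>1 - Y\<close> squares to
    \<open>1 - ?X\<close>, the square of \<open>A\<close>; its form is nonnegative because
    \<open>Y\<close> is a contraction.\<close>
  proof (rule that[of "\<lambda>x. x - Y x"])
    show "bounded_linear (\<lambda>x. x - Y x)" by (intro bounded_linear_sub bounded_linear_ident Y)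
    show "0 \<le> inner (x - Y x) x" for x
    proof -
      have "inner (Y x) x \<le> norm (Y x) * norm x" by (rule norm_cauchy_schwarz)
      also have "\<dots> \<le> norm x * norm x" by (intro mult_right_mono Y) auto
      finally show ?thesis by (simp add: inner_simps power2_norm_eq_inner flip: power2_eq_square)
    qed
    show "x - Y x - Y (x - Y x) = A (A x)" for x
      using Y(3)[of x] by (simp add: linear_diff[OF bounded_linear.linear[OF Y(1)]] scaleR_2 algebra_simps)
    fix C x assume C: "bounded_linear C" "\<And>x. C (A x) = A (C x)"
    then show "C (x - Y x) = C x - Y (C x)"
      using Y(4)[of C] by (simp add: linear_diff[OF bounded_linear.linear])
  qed
qed

text \<open>On \<open>L\<close> the operator \<open>A\<close> agrees with the positive operator
  \<open>B\<close>, and \<open>A \<ge> 0\<close> there means \<open>T \<ge> k\<close>. Both are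
  built from \<open>T\<close>, so every bounded operator commuting with \<open>T\<close> preserves
  \<open>L\<close>.\<close>

lemma ex_spectral_subspace:
  fixes T :: "'a::{real_inner,banach} \<Rightarrow> 'a"
  assumes T: "bounded_linear T" "\<And>x y. inner (T x) y = inner x (T y)"
    and x0: "inner (T x0) x0 > 0"
  obtains L k where "closed L" "subspace L" "L \<noteq> {0}" "k > 0"
    "\<And>x. x \<in> L \<Longrightarrow> k * (norm x)\<^sup>2 \<le> inner (T x) x"
    "\<And>C x. bounded_linear C \<Longrightarrow> (\<And>x. C (T x) = T (C x)) \<Longrightarrow> x \<in> L \<Longrightarrow> C x \<in> L"
proof -
  interpret T: bounded_linear T by fact
  have x0': "x0 \<noteq> 0" using x0 by auto
  \<comment> \<open>Half the Rayleigh quotient of \<open>x0\<close>: positive, yet small enough that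
    the form of \<open>T - k\<close> is still positive at \<open>x0\<close>.\<close>
  define k where "k = inner (T x0) x0 / (2 * (norm x0)\<^sup>2)"
  have k0: "k > 0" using x0 x0' by (simp add: k_def)
  obtain N where N: "\<And>x. norm (T x) \<le> norm x * N" "0 < N" using T.pos_bounded by blast
  \<comment> \<open>Since \<open>T - k\<close> has norm at most \<open>N + k\<close>, this factor
    makes \<open>A\<close> a contraction.\<close>
  define s where "s = 1 / (N + k)"
  have s0: "s > 0" using N k0 by (simp add: s_def)
  define A where "A = (\<lambda>x. s *\<^sub>R (T x - k *\<^sub>R x))"
  have A: "bounded_linear A" unfolding A_def
    by (intro bounded_linear_const_scaleR bounded_linear_sub T bounded_linear_scaleR_right)
  have A_sym: "inner (A x) y = inner x (A y)" for x y
    by (simp add: A_def inner_simps T(2))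
  have A_le: "norm (A x) \<le> norm x" for x
  proof -
    have "norm (T x - k *\<^sub>R x) \<le> norm x * N + k * norm x"
      using norm_triangle_ineq4[of "T x" "k *\<^sub>R x"] N(1)[of x] k0 by simp
    then have "s * norm (T x - k *\<^sub>R x) \<le> s * (norm x * N + k * norm x)"
      using s0 by (intro mult_left_mono) auto
    also have "\<dots> = norm x" using N k0 by (simp add: s_def field_simps)
    finally show ?thesis using s0 by (simp add: A_def)
  qed
  have A_comm: "C (A x) = A (C x)" if "bounded_linear C" "\<And>x. C (T x) = T (C x)" for C x
    using that by (simp add: A_def linear_simps bounded_linear.linear)
  from ex_operator_abs[OF A A_sym A_le] obtain B where B: "bounded_linear B"
    "\<And>x. inner (B x) x \<ge> 0" "\<And>x. B (B x) = A (A x)"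
    "\<And>C x. bounded_linear C \<Longrightarrow> (\<And>x. C (A x) = A (C x)) \<Longrightarrow> C (B x) = B (C x)"
    by blast
  note lA = bounded_linear.linear[OF A] and lB = bounded_linear.linear[OF B(1)]
  define L where "L = {x. B x = A x}"
  show thesis
  proof (rule that[of L k])
    show "closed L" unfolding L_def
      by (intro closed_Collect_eq bounded_linear.continuous_on[OF A] bounded_linear.continuous_on[OF B(1)] continuous_intros)
    show "subspace L" unfolding L_def subspace_def
      by (auto simp: linear_0 linear_add linear_scale lA lB)
    show "k > 0" by fact
    show "k * (norm x)\<^sup>2 \<le> inner (T x) x" if "x \<in> L" for x
    proof -
      have "0 \<le> inner (A x) x" using that B(2)[of x] by (simp add: L_def)
      then have "0 \<le> inner (T x) x - k * (norm x)\<^sup>2"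
        using s0 by (simp add: A_def inner_simps power2_norm_eq_inner zero_le_mult_iff)
      then show ?thesis by simp
    qed
    show "C x \<in> L" if C: "bounded_linear C" "\<And>x. C (T x) = T (C x)" and x: "x \<in> L" for C x
    proof -
      note comm = A_comm[of C, OF C]
      have "B (C x) = C (B x)" by (rule B(4)[of C, OF C(1) comm, symmetric])
      then show ?thesis using x comm[of x] by (simp add: L_def)
    qed
    show "L \<noteq> {0}"
    proof
      assume L0: "L = {0}"
      \<comment> \<open>As \<open>A\<close> and \<open>B\<close> commute,
        \<open>(B - A) (B + A) = B^2 - A^2 = 0\<close>. If \<open>L\<close> were trivial,
        \<open>A\<close> would be \<open>- B\<close> at \<open>x0\<close>, against the choice of
        \<open>k\<close>.\<close>
      have "B x0 + A x0 \<in> L"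
        using B(4)[OF A refl, of x0] by (simp add: L_def linear_add lA lB B(3))
      then have "A x0 = - B x0" using L0 by (simp add: add_eq_0_iff)
      then have "inner (A x0) x0 \<le> 0" using B(2)[of x0] by simp
      then have "inner (T x0) x0 \<le> k * (norm x0)\<^sup>2"
        using s0 by (simp add: A_def inner_simps power2_norm_eq_inner mult_le_0_iff)
      also have "\<dots> = inner (T x0) x0 / 2" using x0' by (simp add: k_def)
      finally show False using x0 by simp
    qed
  qed
qed

text \<open>The Lax-Milgram argument inside \<open>L\<close>: coercivity bounds \<open>T\<close>
  from below, so its image is closed, and a vector of \<open>L\<close> orthogonal to that image is
  orthogonal to its own image under \<open>T\<close>, hence zero.\<close>

lemma coercive_surj_on_subspace:
  fixes T :: "'a::{real_inner,banach} \<Rightarrow> 'a"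
  assumes T: "bounded_linear T" and L: "closed L" "subspace L" "\<And>x. x \<in> L \<Longrightarrow> T x \<in> L"
    and k: "k > 0" "\<And>x. x \<in> L \<Longrightarrow> k * (norm x)\<^sup>2 \<le> inner (T x) x"
  shows "T ` L = L"
proof
  show sub: "T ` L \<subseteq> L" using L by auto
  have lower: "k * norm x \<le> norm (T x)" if "x \<in> L" for x
  proof -
    have "k * (norm x)\<^sup>2 \<le> norm (T x) * norm x"
      using k(2)[OF that] norm_cauchy_schwarz[of "T x" x] by linarith
    then show ?thesis by (cases "x = 0") (auto simp: power2_eq_square)
  qed
  have "complete (T ` L)"
    using lower L(1) by (intro complete_isometric_image[OF k(1) L(2) T])
      (simp_all add: complete_eq_closed)
  then have TL: "closed (T ` L)" "subspace (T ` L)"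
    using L(2) T by (simp_all add: complete_eq_closed linear_subspace_image bounded_linear.linear)
  show "L \<subseteq> T ` L"
  proof
    fix y assume y: "y \<in> L"
    define z where "z = y - orth_proj (T ` L) y"
    have "orth_proj (T ` L) y \<in> L" by (rule subsetD[OF sub orth_proj_in[OF TL]])
    with y L(2) have z: "z \<in> L" unfolding z_def by (intro subspace_diff)
    then have "inner z (T z) = 0" unfolding z_def by (intro orth_proj_orth[OF TL] imageI)
    then have "k * (norm z)\<^sup>2 \<le> 0" using k(2)[OF z] by (simp add: inner_commute)
    then have "z = 0" using k(1) by (simp add: mult_le_0_iff)
    then have "y = orth_proj (T ` L) y" by (simp add: z_def)
    then show "y \<in> T ` L" using orth_proj_in[OF TL, of y] by (rule ssubst)
  qed
qed

section \<open>Irreducibility and cohomology\<close>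

text \<open>Exhibits \<open>cnj c\<close> as the real adjoint of multiplication by \<open>c\<close>,
  so that complex scalars can be handled by the same commutation lemmas as the operators
  \<open>\<pi> g\<close>.\<close>

lemma inner_scaleC_left: "inner (c *\<^sub>C x) y = inner x (cnj c *\<^sub>C y)"
  by (simp add: inner_eq_Re_cinner cinner_scaleC_left cinner_commute[of x])

lemma bounded_linear_scaleC: "bounded_linear (\<lambda>x :: 'h::complex_hilbert_space. c *\<^sub>C x)"
proof (rule bounded_linear_intro[where K = "cmod c"])
  show "c *\<^sub>C (r *\<^sub>R x) = r *\<^sub>R (c *\<^sub>C x)" for r and x :: 'h
    by (simp add: scaleR_scaleC scaleC_scaleC mult.commute)
  fix x :: 'h
  have "(norm (c *\<^sub>C x))\<^sup>2 = inner x ((cnj c * c) *\<^sub>C x)"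
    by (simp add: power2_norm_eq_inner inner_scaleC_left scaleC_scaleC)
  also have "cnj c * c = complex_of_real ((cmod c)\<^sup>2)"
    by (simp only: complex_norm_square mult.commute)
  finally have "(norm (c *\<^sub>C x))\<^sup>2 = (norm x * cmod c)\<^sup>2"
    by (simp add: power2_norm_eq_inner power_mult_distrib flip: scaleR_scaleC)
  then have "norm (c *\<^sub>C x) = norm x * cmod c" by (rule power2_eq_imp_eq) auto
  then show "norm (c *\<^sub>C x) \<le> norm x * cmod c" by simp
qed (simp add: scaleC_add_right)

lemma bounded_operator_orth_proj:
  fixes L :: "'h::complex_hilbert_space set"
  assumes "closed L" "subspace L" "\<And>c x. x \<in> L \<Longrightarrow> c *\<^sub>C x \<in> L"
  shows "bounded_operator (orth_proj L)"
  unfolding bounded_operator_def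
proof (intro conjI allI)
  show "bounded_linear (orth_proj L)" by (rule bounded_linear_orth_proj[OF assms(1,2)])
  show "orth_proj L (c *\<^sub>C x) = c *\<^sub>C orth_proj L x" for c x
    by (rule orth_proj_commute[OF assms(1,2) bounded_linear.linear[OF bounded_linear_scaleC]
          inner_scaleC_left assms(3) assms(3)])
qed

section \<open>Invariant affine subspaces of an affine action\<close>

context
  fixes \<pi> :: "'g::topological_group_add \<Rightarrow> 'h::complex_hilbert_space \<Rightarrow> 'h"
  assumes rep: "unitary_representation \<pi>"
begin

lemma rep_bounded_linear: "bounded_linear (\<pi> g)"
  using rep_linear[OF rep] by (simp add: bounded_operator_def)

lemma rep_adjoint: "inner (\<pi> g x) y = inner x (\<pi> (- g) y)"
proof -
  have "\<pi> (g + - g) y = \<pi> g (\<pi> (- g) y)"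
    using rep unfolding unitary_representation_def by (metis comp_apply)
  moreover have "\<pi> (g + - g) y = y" using rep by (simp add: unitary_representation_def)
  ultimately have "inner (\<pi> g x) y = inner (\<pi> g x) (\<pi> g (\<pi> (- g) y))" by simp
  also have "\<dots> = inner x (\<pi> (- g) y)"
    using rep by (simp add: inner_eq_Re_cinner unitary_representation_def unitary_operator_def)
  finally show ?thesis .
qed

lemma orth_proj_commutant:
  assumes "closed L" "subspace L" "\<And>c x. x \<in> L \<Longrightarrow> c *\<^sub>C x \<in> L" "\<And>g x. x \<in> L \<Longrightarrow> \<pi> g x \<in> L"
  shows "orth_proj L \<in> commutant \<pi>"
proof -
  have "orth_proj L (\<pi> g x) = \<pi> g (orth_proj L x)" for g x
    by (rule orth_proj_commute[OF assms(1,2) bounded_linear.linear[OF rep_bounded_linear]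
          rep_adjoint assms(4) assms(4)])
  then show ?thesis
    using bounded_operator_orth_proj[OF assms(1-3)] by (simp add: commutant_def fun_eq_iff)
qed

text \<open>The map sending \<open>x\<close> to \<open>R x + w\<close> intertwines
  \<open>\<alpha>\<close> with \<open>\<pi>\<close>, and \<open>\<pi>\<close> fixes 0, so its zero
  set is invariant. That the set is non-empty and proper is settled where it is used.\<close>

lemma invariant_affine_subspace:
  assumes R: "R \<in> commutant \<pi>" "\<And>g. R (b g) = \<pi> g w - w"
    and \<alpha>: "\<And>g v. \<alpha> g v = \<pi> g v + b g"
  shows "closed {x. R x + w = 0}" "complex_affine {x. R x + w = 0}"
    "\<alpha> g ` {x. R x + w = 0} \<subseteq> {x. R x + w = 0}"
proof -
  have bo: "bounded_operator R" and comm: "\<And>g x. R (\<pi> g x) = \<pi> g (R x)"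
    using R(1) by (auto simp: commutant_def fun_eq_iff)
  then have bl: "bounded_linear R" and sc: "\<And>c x. R (c *\<^sub>C x) = c *\<^sub>C R x"
    by (auto simp: bounded_operator_def)
  show "closed {x. R x + w = 0}"
    by (intro closed_Collect_eq continuous_intros bounded_linear.continuous_on[OF bl])
  show "complex_affine {x. R x + w = 0}" unfolding complex_affine_def
  proof safe
    fix x y c d assume *: "R x + w = 0" "R y + w = 0" "c + d = (1::complex)"
    have "R (c *\<^sub>C x + d *\<^sub>C y) = c *\<^sub>C R x + d *\<^sub>C R y"
      by (simp add: bounded_operator_simps[OF bo] sc)
    also have "R x = - w" using *(1) by (simp add: eq_neg_iff_add_eq_0)
    also have "R y = - w" using *(2) by (simp add: eq_neg_iff_add_eq_0)
    also have "c *\<^sub>C (- w) + d *\<^sub>C (- w) = (c + d) *\<^sub>C (- w)" by (simp only: scaleC_add_left)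
    also have "\<dots> = - w" using *(3) scaleR_scaleC[of 1 "- w"] by simp
    finally show "R (c *\<^sub>C x + d *\<^sub>C y) + w = 0" by simp
  qed
  have eq: "R (\<alpha> g x) + w = \<pi> g (R x + w)" for x
    by (simp add: \<alpha> bounded_operator_simps[OF bo] bounded_operator_simps[OF rep_linear[OF rep]]
        comm R(2))
  show "\<alpha> g ` {x. R x + w = 0} \<subseteq> {x. R x + w = 0}"
  proof clarify
    fix x assume "R x + w = 0"
    then show "R (\<alpha> g x) + w = 0"
      unfolding eq by (simp only: bounded_operator_simps(4)[OF rep_linear[OF rep]])
  qed
qed

lemma irreducible_imp_not_coboundary:
  assumes \<alpha>: "\<And>g v. \<alpha> g v = \<pi> g v + b g" and irr: "irreducible_action \<alpha>"
    and S: "S \<in> commutant \<pi>" and cob: "(\<lambda>g. S (b g)) \<in> B1 \<pi>"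
  shows "S = (\<lambda>_. 0)"
proof (rule ccontr)
  assume "S \<noteq> (\<lambda>_. 0)"
  then obtain x0 where x0: "S x0 \<noteq> 0" by auto
  obtain v where v: "\<And>g. S (b g) = \<pi> g v - v" using cob by (auto simp: B1_def fun_eq_iff)
  have bl: "bounded_linear S" and Sc: "\<And>c x. S (c *\<^sub>C x) = c *\<^sub>C S x"
    and S\<pi>: "\<And>g x. S (\<pi> g x) = \<pi> g (S x)"
    using S by (auto simp: commutant_def fun_eq_iff bounded_operator_def)
  obtain S' where S': "bounded_linear S'" "\<And>x y. inner (S x) y = inner x (S' y)"
    using ex_adjoint[OF bl] by blast
  \<comment> \<open>The adjoint of \<open>S\<close> commutes with \<open>C\<close> once
    \<open>S\<close> commutes with the adjoint of \<open>C\<close>. This is applied to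
    \<open>\<pi> g\<close>, with adjoint \<open>\<pi> (- g)\<close>, and to complex scalars.\<close>
  have S'comm: "C (S' y) = S' (C y)"
    if "\<And>x y. inner (C x) y = inner x (C' y)" "\<And>x. S (C' x) = C' (S x)" for C C' y
  proof (rule vector_eq_ldot[THEN iffD1, rule_format])
    fix x
    have "inner x (C (S' y)) = inner (S (C' x)) y"
      by (metis that(1) inner_commute S'(2))
    also have "\<dots> = inner x (S' (C y))"
      by (metis that inner_commute S'(2))
    finally show "inner x (C (S' y)) = inner x (S' (C y))" .
  qed
  have S'\<pi>: "\<pi> g (S' y) = S' (\<pi> g y)" for g y
    by (rule S'comm[OF rep_adjoint S\<pi>])
  have S'c: "c *\<^sub>C S' y = S' (c *\<^sub>C y)" for c y
    by (rule S'comm[OF inner_scaleC_left Sc])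
  define T where "T = (\<lambda>x. S' (S x))"
  have T: "bounded_linear T" unfolding T_def by (rule bounded_linear_compose[OF S'(1) bl])
  have T_sym: "inner (T x) y = inner x (T y)" for x y
    by (metis T_def S'(2) inner_commute)
  have "inner (T x0) x0 = inner (S x0) (S x0)"
    by (metis T_def S'(2) inner_commute)
  then have "inner (T x0) x0 > 0" using x0 by simp
  from ex_spectral_subspace[OF T T_sym this] obtain L k where
    L: "closed L" "subspace L" "L \<noteq> {0}" and k: "k > 0"
    "\<And>x. x \<in> L \<Longrightarrow> k * (norm x)\<^sup>2 \<le> inner (T x) x"
    and inv: "\<And>C x. bounded_linear C \<Longrightarrow> (\<And>x. C (T x) = T (C x)) \<Longrightarrow> x \<in> L \<Longrightarrow> C x \<in> L"
    by metis
  have L_T: "T x \<in> L" if "x \<in> L" for x by (rule inv[OF T refl that])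
  have T\<pi>: "\<pi> g (T x) = T (\<pi> g x)" for g x by (simp add: T_def S'\<pi> S\<pi>)
  have L_\<pi>: "\<pi> g x \<in> L" if "x \<in> L" for g x by (rule inv[OF rep_bounded_linear T\<pi> that])
  have L_c: "c *\<^sub>C x \<in> L" if "x \<in> L" for c x
    by (rule inv[OF bounded_linear_scaleC _ that]) (simp add: T_def S'c Sc)
  let ?P = "orth_proj L"
  note P_in = orth_proj_in[OF L(1,2)]
  have P: "?P \<in> commutant \<pi>" by (intro orth_proj_commutant L L_c L_\<pi>)
  then have P\<pi>: "?P (\<pi> g x) = \<pi> g (?P x)" for g x by (auto simp: commutant_def fun_eq_iff)
  have PT: "?P (T x) = T (?P x)" for x
    by (rule orth_proj_commute[OF L(1,2) bounded_linear.linear[OF T] T_sym L_T L_T])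
  \<comment> \<open>Inverts \<open>T\<close> on \<open>L\<close> to obtain the vector whose
    coboundary is \<open>?P\<close> applied to \<open>b\<close>.\<close>
  have "?P (S' v) \<in> T ` L"
    using coercive_surj_on_subspace[OF T L(1,2) L_T k] P_in by simp
  then obtain w where w: "w \<in> L" "T w = ?P (S' v)" by auto
  note diff = linear_diff[OF bounded_linear.linear]
  have "?P (b g) = \<pi> g w - w" for g
  proof -
    let ?u = "?P (b g) - (\<pi> g w - w)"
    have u: "?u \<in> L" using P_in w L_\<pi> L(2) by (simp add: subspace_diff)
    \<comment> \<open>Both sides of the claim lie in \<open>L\<close> and have the same image under
      \<open>T\<close>, which is injective on \<open>L\<close> by coercivity.\<close>
    have "T (?P (b g)) = ?P (S' (\<pi> g v - v))" by (simp add: PT[symmetric]) (simp add: T_def v)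
    also have "\<dots> = \<pi> g (T w) - T w"
      by (simp add: diff S'(1) bounded_linear_orth_proj L P\<pi> w flip: S'\<pi>)
    finally have "T ?u = 0" by (simp add: diff T T\<pi>)
    then have "k * (norm ?u)\<^sup>2 \<le> 0" using k(2)[OF u] by simp
    then show ?thesis using k(1) by (simp add: mult_le_0_iff)
  qed
  note aff = invariant_affine_subspace[where \<alpha> = \<alpha>, OF P this \<alpha>]
  have "- w \<in> L" using w L(2) by (simp add: subspace_neg)
  then have ne: "- w \<in> {x. ?P x + w = 0}" by (simp add: orth_proj_ident[OF L(1,2)])
  have "{x. ?P x + w = 0} = UNIV"
  proof (rule ccontr)
    assume "{x. ?P x + w = 0} \<noteq> UNIV"
    moreover have "{x. ?P x + w = 0} \<noteq> {}" using ne by blast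
    ultimately have "\<not> irreducible_action \<alpha>" using aff unfolding irreducible_action_def not_not
      by (intro exI[of _ "{x. ?P x + w = 0}"] conjI allI)
    with irr show False by contradiction
  qed
  then have all: "?P x + w = 0" for x unfolding set_eq_iff by simp
  \<comment> \<open>If the zero set is the whole space, \<open>?P\<close> is constant; being the
    identity on \<open>L\<close>, it leaves only \<open>L = {0}\<close>.\<close>
  have "x = 0" if x: "x \<in> L" for x
    using all[of x] all[of 0]
    unfolding orth_proj_ident[OF L(1,2) x] orth_proj_ident[OF L(1,2) subspace_0[OF L(2)]] by simp
  then show False using L(3) subspace_0[OF L(2)] by blast
qed

lemma not_coboundary_imp_irreducible:
  assumes \<alpha>: "\<And>g v. \<alpha> g v = \<pi> g v + b g"
    and sep: "\<And>S. S \<in> commutant \<pi> \<Longrightarrow> (\<lambda>g. S (b g)) \<in> B1 \<pi> \<Longrightarrow> S = (\<lambda>_. 0)"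
  shows "irreducible_action \<alpha>"
  unfolding irreducible_action_def
proof
  assume "\<exists>E. E \<noteq> {} \<and> E \<noteq> UNIV \<and> closed E \<and> complex_affine E \<and> (\<forall>g. \<alpha> g ` E \<subseteq> E)"
  then obtain E s where s: "s \<in> E"
    and E: "closed E" "complex_affine E" "\<forall>g. \<alpha> g ` E \<subseteq> E" "E \<noteq> UNIV" by blast
  \<comment> \<open>The direction of \<open>E\<close>, obtained by translating \<open>s\<close> to
    the origin; it will be a closed \<open>\<pi>\<close>-invariant complex subspace.\<close>
  define K where "K = {x. x + s \<in> E}"
  have one: "1 *\<^sub>C x = x" for x :: 'h using scaleR_scaleC[of 1 x] by simp
  have aff: "c *\<^sub>C x + (1 - c) *\<^sub>C y \<in> E" if "x \<in> E" "y \<in> E" for c x y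
    using E(2) that by (auto simp: complex_affine_def)
  have K_c: "c *\<^sub>C x \<in> K" if "x \<in> K" for c x
  proof -
    have "c *\<^sub>C (x + s) + (1 - c) *\<^sub>C s \<in> E" using that s by (intro aff) (auto simp: K_def)
    also have "c *\<^sub>C (x + s) + (1 - c) *\<^sub>C s = c *\<^sub>C x + (c + (1 - c)) *\<^sub>C s"
      by (simp only: scaleC_add_right scaleC_add_left add.assoc)
    finally show ?thesis by (simp add: K_def one)
  qed
  have K_add: "x + y \<in> K" if "x \<in> K" "y \<in> K" for x y
  proof -
    \<comment> \<open>Affine combinations give only the midpoint; closure of \<open>K\<close> under
      scalars then doubles it.\<close>
    have "(1/2) *\<^sub>C (x + s) + (1 - 1/2) *\<^sub>C (y + s) \<in> E"
      using that by (intro aff) (auto simp: K_def)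
    also have "(1/2) *\<^sub>C (x + s) + (1 - 1/2) *\<^sub>C (y + s) = (1/2) *\<^sub>C (x + y) + (1/2 + 1/2) *\<^sub>C s"
      by (simp only: scaleC_add_right scaleC_add_left) (simp add: add_ac)
    finally have "(1/2) *\<^sub>C (x + y) \<in> K" by (simp add: K_def one)
    from K_c[OF this, of 2] show ?thesis by (simp add: scaleC_scaleC one)
  qed
  have K: "closed K" "subspace K"
  proof -
    show "closed K"
      using continuous_closed_vimage[OF E(1), of "\<lambda>x. x + s"] by (simp add: K_def vimage_def)
    show "subspace K"
      using K_c K_add s by (auto simp: subspace_def scaleR_scaleC) (simp add: K_def)
  qed
  have diff: "x - y \<in> K" if "x \<in> E" "y \<in> E" for x y
    using that subspace_diff[OF K(2), of "x - s" "y - s"] by (simp add: K_def)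
  have \<alpha>E: "\<alpha> g x \<in> E" if "x \<in> E" for g x using E(3) that by blast
  note lin\<pi> = bounded_operator_simps[OF rep_linear[OF rep]]
  \<comment> \<open>\<open>\<pi> g x\<close> is the difference of \<open>\<alpha> g (x + s)\<close>
    and \<open>\<alpha> g s\<close>, two points of \<open>E\<close>.\<close>
  have K_\<pi>: "\<pi> g x \<in> K" if "x \<in> K" for g x
    using diff[OF \<alpha>E[of "x + s" g] \<alpha>E[OF s, of g]] that by (simp add: K_def \<alpha> lin\<pi>)
  let ?Q = "orth_proj K"
  let ?P = "\<lambda>x. x - ?Q x"
  have Q: "bounded_linear ?Q" "\<And>c x. ?Q (c *\<^sub>C x) = c *\<^sub>C ?Q x" "\<And>g x. ?Q (\<pi> g x) = \<pi> g (?Q x)"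
    using orth_proj_commutant[OF K K_c K_\<pi>]
    by (auto simp: commutant_def fun_eq_iff bounded_operator_def)
  have P: "?P \<in> commutant \<pi>"
    by (auto simp: commutant_def fun_eq_iff bounded_operator_def Q lin\<pi>
        linear_diff[OF bounded_linear.linear[OF bounded_linear_scaleC]]
        intro!: bounded_linear_sub Q bounded_linear_ident)
  \<comment> \<open>The displacement \<open>\<alpha> g s - s\<close> lies in \<open>K\<close> and is
    killed by \<open>?P\<close>; solving for \<open>?P (b g)\<close> gives the coboundary of
    \<open>- ?P s\<close>.\<close>
  have "?P (b g) = \<pi> g (- ?P s) - (- ?P s)" for g
  proof -
    have "\<pi> g s + b g - s \<in> K" using diff[OF \<alpha>E[OF s, of g] s] by (simp add: \<alpha>)
    then have "?Q (\<pi> g s + b g - s) = \<pi> g s + b g - s" by (rule orth_proj_ident[OF K])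
    then have "\<pi> g (?Q s) + ?Q (b g) - ?Q s = \<pi> g s + b g - s"
      by (simp add: linear_diff[OF bounded_linear.linear[OF Q(1)]]
          linear_add[OF bounded_linear.linear[OF Q(1)]] Q(3))
    then show ?thesis by (simp add: lin\<pi> algebra_simps)
  qed
  then have "(\<lambda>g. ?P (b g)) \<in> B1 \<pi>" unfolding B1_def by blast
  \<comment> \<open>Separation gives \<open>?P = 0\<close>, so every vector equals its projection
    onto \<open>K\<close>, and \<open>E\<close> is everything.\<close>
  from sep[OF P this] have "x \<in> K" for x
    using orth_proj_in[OF K, of x] by (simp add: fun_eq_iff)
  from this[of "y - s" for y] have "E = UNIV" by (auto simp: K_def)
  with E(4) show False ..
qed

text \<open>A class vanishes exactly when its representative is a coboundary, so separation can be
  tested on a cocycle without passing to the quotient.\<close>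

lemma H1_separating_class_iff:
  assumes b: "b \<in> Z1 \<pi>"
  shows "H1_separating \<pi> (H1_class \<pi> b) \<longleftrightarrow>
    (\<forall>S\<in>commutant \<pi>. (\<lambda>g. S (b g)) \<in> B1 \<pi> \<longrightarrow> S = (\<lambda>_. 0))"
proof -
  have "H1_act \<pi> S (H1_class \<pi> b) = H1_class \<pi> (\<lambda>_. 0) \<longleftrightarrow> (\<lambda>g. S (b g)) \<in> B1 \<pi>"
    if S: "S \<in> commutant \<pi>" for S
  proof -
    have "(\<lambda>_. 0) \<in> Z1 \<pi>" using zero_in_B1[OF rep] B1_subset_Z1[OF rep] by blast
    then show ?thesis
      unfolding H1_act_class[OF rep S b] unfolding H1_class_def
      using commutant_Z1[OF S b]
      by (simp add: eq_equiv_class_iff[OF equiv_cohomologous[OF rep]]) (simp add: cohomologous_def)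
  qed
  moreover have "H1_class \<pi> b \<in> H1 \<pi>" using b by (simp add: H1_def H1_class_def quotientI)
  ultimately show ?thesis by (simp add: H1_separating_def)
qed

end

theorem corollary3p5:
  fixes \<pi> :: "'g::topological_group_add \<Rightarrow> 'h::complex_hilbert_space \<Rightarrow> 'h"
  assumes "unitary_representation \<pi>"
  shows "(\<exists>\<alpha>. affine_isometric_action \<pi> \<alpha> \<and> irreducible_action \<alpha>) \<longleftrightarrow>
         (\<exists>\<xi>. H1_separating \<pi> \<xi>)"
proof
  assume "\<exists>\<alpha>. affine_isometric_action \<pi> \<alpha> \<and> irreducible_action \<alpha>"
  then obtain \<alpha> b where b: "b \<in> Z1 \<pi>" and \<alpha>: "\<And>g v. \<alpha> g v = \<pi> g v + b g"
    and irr: "irreducible_action \<alpha>"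
    by (auto simp: affine_isometric_action_def)
  have "H1_separating \<pi> (H1_class \<pi> b)"
    using irreducible_imp_not_coboundary[where \<alpha> = \<alpha>, OF assms \<alpha> irr]
    by (simp add: H1_separating_class_iff[OF assms b])
  then show "\<exists>\<xi>. H1_separating \<pi> \<xi>" ..
next
  assume "\<exists>\<xi>. H1_separating \<pi> \<xi>"
  then obtain \<xi> where \<xi>: "H1_separating \<pi> \<xi>" ..
  then obtain b where b: "b \<in> Z1 \<pi>" "\<xi> = H1_class \<pi> b"
    by (auto simp: H1_separating_def H1_def H1_class_def elim: quotientE)
  have "irreducible_action (\<lambda>g v. \<pi> g v + b g)"
    using \<xi> by (intro not_coboundary_imp_irreducible[OF assms refl])
      (simp add: b(2) H1_separating_class_iff[OF assms b(1)])
  moreover have "affine_isometric_action \<pi> (\<lambda>g v. \<pi> g v + b g)"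
    using b(1) by (auto simp: affine_isometric_action_def)
  ultimately show "\<exists>\<alpha>. affine_isometric_action \<pi> \<alpha> \<and> irreducible_action \<alpha>" by blast
qed

end
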